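(* Let $S$ be a finite set of lines in the real projective plane, with each line coloured red or blue or with both colours. Suppose that for any two distinct lines $\ell,m\in S$ sharing a colour there is a third line $n\in S$ of the other colour, concurrent with $\ell$ and $m$. Then all the lines in $S$ are concurrent.
   Context: A line may carry one colour or both colours; "red" includes lines carrying both colours, and likewise "blue". The hypothesis means: whenever $\ell\neq m$ in $S$ are both blue, there is a red line $n\in S\setminus\{\ell,m\}$ through the point $\ell\cap m$; and whenever $\ell\neq m$ in $S$ are both red, there is a blue line $n\in S\setminus\{\ell,m\}$ through $\ell\cap m$. (If $\ell,m$ share both colours, both requirements apply.) The line $n$ is allowed to carry both colours. Lines are concurrent if they all pass through a common point. *)

theory Defs
  imports "HOL-Analysis.Analysis"
begin

text \<open>
  The real projective plane in its linear model: points and lines are the linear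
  subspaces of dimension 1 and 2 of \<open>\<real>\<^sup>3\<close>, and a point lies on a line
  iff it is contained in it.
\<close>

definition proj_point :: "(real ^ 3) set \<Rightarrow> bool" where
  "proj_point p \<longleftrightarrow> subspace p \<and> dim p = 1"

definition proj_line :: "(real ^ 3) set \<Rightarrow> bool" where
  "proj_line l \<longleftrightarrow> subspace l \<and> dim l = 2"

definition concurrent :: "(real ^ 3) set set \<Rightarrow> bool" where
  "concurrent L \<longleftrightarrow> (\<exists>p. proj_point p \<and> (\<forall>l\<in>L. p \<subseteq> l))"

end

theory Submission
  imports Defs
begin

text \<open>
  The proof is a descent on triangles cut out by lines of \<open>S\<close>. Consider a triangle \<open>abc\<close> whose
  sides \<open>ab\<close> and \<open>ac\<close> are blue and whose side \<open>bc\<close> is red. The hypothesis gives a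
  red line through \<open>a\<close>, and among the four triangular regions that three lines bound in the
  projective plane, take one that this red line crosses, in a point \<open>d\<close> of the side \<open>bc\<close>. Two
  red lines meet at \<open>d\<close>, so there is a blue line through \<open>d\<close>; it leaves the triangle through one of the
  two blue sides, say at \<open>e\<close> between \<open>a\<close> and \<open>b\<close>. Two blue lines meet at \<open>e\<close>, so there is a red
  line through \<open>e\<close>. The triangles \<open>ebd\<close> and \<open>ead\<close> both have two blue sides at \<open>e\<close> and a red
  side opposite to it, and the red line through \<open>e\<close> crosses one of them. That triangle is properly
  contained in \<open>abc\<close> and of the same kind, which is impossible in a finite arrangement.

  So every red line passes through the meeting point of any two blue lines. This leaves a
  pencil: if \<open>l\<close> and \<open>m\<close> are blue lines through \<open>a\<close> and a blue line \<open>k\<close> missed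
  \<open>a\<close>, then the red third line through \<open>l \<inter> k\<close> would also contain \<open>a\<close> and be \<open>l\<close>
  itself. If no two lines are blue, the same argument applies with the colours exchanged, unless
  there are at most one blue and one red line, and these meet anyway.

  In the linear model a triangular region is a cone spanned by three
  vectors. Representatives can be rescaled so that \<open>d = b + c\<close>, and then the order
  of points on a line is just a matter of the signs of coefficients.
\<close>

section \<open>Points and lines in coordinates\<close>

text \<open>
  Independence is stated for three named vectors, as the membership tests below all end in a
  comparison of coefficients.
\<close>

definition lin_indep3 :: "'a::real_vector \<Rightarrow> 'a \<Rightarrow> 'a \<Rightarrow> bool" where
  "lin_indep3 a b c \<longleftrightarrow>
     (\<forall>x y z. x *\<^sub>R a + y *\<^sub>R b + z *\<^sub>R c = 0 \<longrightarrow> x = 0 \<and> y = 0 \<and> z = 0)"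

lemma lin_indep3D:
  assumes "lin_indep3 a b c" "x *\<^sub>R a + y *\<^sub>R b + z *\<^sub>R c = 0"
  shows "x = 0" "y = 0" "z = 0"
  using assms unfolding lin_indep3_def by blast+

lemma lin_indep3_imp_independent:
  assumes "lin_indep3 a b c"
  shows "independent {a, b, c}" "card {a, b, c} = 3"
proof -
  have ne: "a \<noteq> b" "a \<noteq> c" "b \<noteq> c"
    using lin_indep3D[OF assms, of 1 "-1" 0] lin_indep3D[OF assms, of 1 0 "-1"]
      lin_indep3D[OF assms, of 0 1 "-1"] by auto
  then show "card {a, b, c} = 3" by simp
  have "u v = 0" if "(\<Sum>v\<in>{a, b, c}. u v *\<^sub>R v) = 0" "v \<in> {a, b, c}" for u v
  proof -
    have "u a *\<^sub>R a + u b *\<^sub>R b + u c *\<^sub>R c = 0"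
      using that(1) ne by (simp add: add.assoc)
    from lin_indep3D[OF assms this] that(2) show ?thesis by auto
  qed
  then show "independent {a, b, c}"
    by (subst dependent_finite) auto
qed

lemma line_subspace: "proj_line l \<Longrightarrow> subspace l"
  by (simp add: proj_line_def)

lemma line_scaleD:
  assumes "proj_line l" "x *\<^sub>R v \<in> l" "x \<noteq> 0"
  shows "v \<in> l"
  using subspace_scale[OF line_subspace[OF assms(1)] assms(2), of "1 / x"] assms(3) by simp

lemma line_add_scale: "proj_line l \<Longrightarrow> u \<in> l \<Longrightarrow> v \<in> l \<Longrightarrow> u + x *\<^sub>R v \<in> l"
  by (intro subspace_add subspace_scale line_subspace)

lemma line_not_lin_indep3:
  assumes "proj_line l" "a \<in> l" "b \<in> l" "c \<in> l"
  shows "\<not> lin_indep3 a b c"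
proof
  assume *: "lin_indep3 a b c"
  have "card {a, b, c} \<le> dim l"
    using lin_indep3_imp_independent(1)[OF *] assms(2-4)
    by (intro independent_card_le_dim) auto
  with lin_indep3_imp_independent(2)[OF *] assms(1) show False
    by (simp add: proj_line_def)
qed

text \<open>
  Two subspaces of dimension 2 cannot intersect trivially in a space of dimension 3.
\<close>

lemma lines_meet:
  assumes "proj_line l" "proj_line m"
  obtains v where "v \<in> l" "v \<in> m" "v \<noteq> 0"
proof -
  have "dim {x + y |x y. x \<in> l \<and> y \<in> m} + dim (l \<inter> m) = dim l + dim m"
    using assms by (intro dim_sums_Int) (auto simp: proj_line_def)
  moreover have "dim {x + y |x y. x \<in> l \<and> y \<in> m} \<le> 3"
    using dim_subset_UNIV[of "{x + y |x y. x \<in> l \<and> y \<in> m}"] by simp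
  ultimately have "dim (l \<inter> m) \<noteq> 0"
    using assms by (auto simp only: proj_line_def)
  then show thesis
    using that by (auto simp: dim_eq_0)
qed

lemma mem_line_coords:
  assumes l: "proj_line l" "u \<in> l" "v \<in> l" "w \<in> l"
    and uv: "\<And>x y. x *\<^sub>R u + y *\<^sub>R v = 0 \<Longrightarrow> x = 0 \<and> y = 0"
  obtains x y where "w = x *\<^sub>R u + y *\<^sub>R v"
proof -
  from line_not_lin_indep3[OF l] obtain x y z
    where eq: "x *\<^sub>R u + y *\<^sub>R v + z *\<^sub>R w = 0" and nz: "\<not> (x = 0 \<and> y = 0 \<and> z = 0)"
    unfolding lin_indep3_def by blast
  have "z \<noteq> 0" using uv[of x y] eq nz by auto
  have "z *\<^sub>R w = (- x) *\<^sub>R u + (- y) *\<^sub>R v"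
    using eq by (simp add: algebra_simps eq_neg_iff_add_eq_0)
  then have "(1 / z) *\<^sub>R (z *\<^sub>R w) = (- x / z) *\<^sub>R u + (- y / z) *\<^sub>R v"
    by (simp add: scaleR_right_distrib divide_inverse mult.commute scaleR_right_diff_distrib)
  with \<open>z \<noteq> 0\<close> have "w = (- x / z) *\<^sub>R u + (- y / z) *\<^sub>R v" by simp
  then show thesis by (rule that)
qed

lemma line_unique:
  assumes "proj_line l" "u \<in> l" "v \<in> l" "proj_line m" "u \<in> m" "v \<in> m"
    and uv: "\<And>x y. x *\<^sub>R u + y *\<^sub>R v = 0 \<Longrightarrow> x = 0 \<and> y = 0"
  shows "l = m"
proof -
  have "p \<subseteq> q" if "proj_line p" "u \<in> p" "v \<in> p" "proj_line q" "u \<in> q" "v \<in> q" for p q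
  proof
    fix w assume "w \<in> p"
    with mem_line_coords[OF that(1-3) _ uv] obtain x y where "w = x *\<^sub>R u + y *\<^sub>R v"
      by metis
    then show "w \<in> q"
      using that line_subspace[OF that(4)] by (simp add: subspace_add subspace_scale)
  qed
  from this[of l m] this[of m l] show ?thesis using assms(1-6) by blast
qed

text \<open>
  The points \<open>u\<close> and \<open>v\<close> divide the projective line \<open>m\<close> into two segments, and the sign of \<open>s\<close> tells
  in which of them \<open>l\<close> meets \<open>m\<close>.
\<close>

lemma line_crosses_line:
  assumes l: "proj_line l" and m: "proj_line m" "u \<in> m" "v \<in> m" and "u \<notin> l" "v \<notin> l"
    and uv: "\<And>x y. x *\<^sub>R u + y *\<^sub>R v = 0 \<Longrightarrow> x = 0 \<and> y = 0"
  obtains s where "s \<noteq> 0" "u + s *\<^sub>R v \<in> l"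
proof -
  obtain f where f: "f \<in> l" "f \<in> m" "f \<noteq> 0"
    using lines_meet[OF l m(1)] by blast
  obtain x y where xy: "f = x *\<^sub>R u + y *\<^sub>R v"
    using mem_line_coords[OF m f(2) uv] by blast
  have "x \<noteq> 0" "y \<noteq> 0"
    using f xy line_scaleD[OF l] \<open>u \<notin> l\<close> \<open>v \<notin> l\<close> by auto
  moreover have "x *\<^sub>R (u + (y / x) *\<^sub>R v) \<in> l"
    using f(1) xy \<open>x \<noteq> 0\<close> by (simp add: scaleR_right_distrib)
  ultimately show thesis
    using that[of "y / x"] line_scaleD[OF l] by simp
qed

lemma distinct_lines_inter:
  assumes "proj_line l" "proj_line m" "l \<noteq> m" "u \<in> l" "u \<in> m" "u \<noteq> 0" "v \<in> l" "v \<in> m"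
  obtains k where "v = k *\<^sub>R u"
proof -
  from line_unique[of l u v m] assms obtain x y
    where eq: "x *\<^sub>R u + y *\<^sub>R v = 0" and nz: "\<not> (x = 0 \<and> y = 0)"
    by metis
  have "y \<noteq> 0" using eq nz \<open>u \<noteq> 0\<close> by auto
  have "y *\<^sub>R v = (- x) *\<^sub>R u" using eq by (simp add: algebra_simps eq_neg_iff_add_eq_0)
  then have "(1 / y) *\<^sub>R (y *\<^sub>R v) = (1 / y) *\<^sub>R ((- x) *\<^sub>R u)" by simp
  with \<open>y \<noteq> 0\<close> have "v = (- x / y) *\<^sub>R u" by simp
  then show thesis by (rule that)
qed

lemma concurrentI:
  assumes "v \<noteq> 0" "\<And>l. l \<in> L \<Longrightarrow> proj_line l" "\<And>l. l \<in> L \<Longrightarrow> v \<in> l"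
  shows "concurrent L"
proof -
  have "proj_point (span {v})"
    using assms(1) by (simp add: proj_point_def)
  moreover have "span {v} \<subseteq> l" if "l \<in> L" for l
    using assms that by (intro span_minimal) (auto simp: proj_line_def)
  ultimately show ?thesis unfolding concurrent_def by blast
qed

text \<open>
  Concurrency only provides some common point. As distinct lines meet in a single point, the third
  line passes through every vector that the first two share.
\<close>

lemma concurrent_third_line:
  assumes "concurrent {l, m, n}" "proj_line l" "proj_line m" "proj_line n" "l \<noteq> m"
    and "v \<in> l" "v \<in> m"
  shows "v \<in> n"
proof -
  from assms(1) obtain p where p: "subspace p" "dim p = 1" "p \<subseteq> l" "p \<subseteq> m" "p \<subseteq> n"
    unfolding concurrent_def proj_point_def by auto
  then obtain u where u: "u \<in> p" "u \<noteq> 0"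
    using dim_eq_0[of p] by auto
  with p obtain k where "v = k *\<^sub>R u"
    using distinct_lines_inter[of l m u v] assms by blast
  with u p show ?thesis
    using line_subspace[OF assms(4)] by (auto simp: subspace_scale)
qed

section \<open>Triangles as cones\<close>

definition cone3 :: "'a::real_vector \<Rightarrow> 'a \<Rightarrow> 'a \<Rightarrow> 'a set" where
  "cone3 a b c = {x *\<^sub>R a + y *\<^sub>R b + z *\<^sub>R c |x y z. x \<ge> 0 \<and> y \<ge> 0 \<and> z \<ge> 0}"

lemma cone3I: "x \<ge> 0 \<Longrightarrow> y \<ge> 0 \<Longrightarrow> z \<ge> 0 \<Longrightarrow> x *\<^sub>R a + y *\<^sub>R b + z *\<^sub>R c \<in> cone3 a b c"
  unfolding cone3_def by blast

lemma cone3_swap: "cone3 a c b = cone3 a b c"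
proof -
  have "cone3 a c b \<subseteq> cone3 a b c" for a b c :: 'a
  proof
    fix v assume "v \<in> cone3 a c b"
    then obtain x y z where "x \<ge> 0" "y \<ge> 0" "z \<ge> 0" "v = x *\<^sub>R a + y *\<^sub>R c + z *\<^sub>R b"
      unfolding cone3_def by blast
    then show "v \<in> cone3 a b c" using cone3I[of x z y a b c] by (simp add: ac_simps)
  qed
  then show ?thesis by blast
qed

lemma lin_indep3_swap: "lin_indep3 a b c \<Longrightarrow> lin_indep3 a c b"
  unfolding lin_indep3_def
proof (intro allI impI)
  fix x y z
  assume "\<forall>x y z. x *\<^sub>R a + y *\<^sub>R b + z *\<^sub>R c = 0 \<longrightarrow> x = 0 \<and> y = 0 \<and> z = 0"
    and "x *\<^sub>R a + y *\<^sub>R c + z *\<^sub>R b = 0"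
  moreover from this(2) have "x *\<^sub>R a + z *\<^sub>R b + y *\<^sub>R c = 0" by (simp add: ac_simps)
  ultimately show "x = 0 \<and> y = 0 \<and> z = 0" by blast
qed

section \<open>The descent\<close>

locale bicoloured_lines =
  fixes Red Blue :: "(real ^ 3) set set"
  assumes finite_lines: "finite (Red \<union> Blue)"
    and lines: "l \<in> Red \<union> Blue \<Longrightarrow> proj_line l"
    and blue_pair: "l \<in> Blue \<Longrightarrow> m \<in> Blue \<Longrightarrow> l \<noteq> m \<Longrightarrow> \<exists>n\<in>Red - {l, m}. concurrent {l, m, n}"
    and red_pair: "l \<in> Red \<Longrightarrow> m \<in> Red \<Longrightarrow> l \<noteq> m \<Longrightarrow> \<exists>n\<in>Blue - {l, m}. concurrent {l, m, n}"
begin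

lemma red_line: "l \<in> Red \<Longrightarrow> proj_line l" and blue_line: "l \<in> Blue \<Longrightarrow> proj_line l"
  using lines by auto

lemma red_through:
  assumes "l \<in> Blue" "m \<in> Blue" "l \<noteq> m" "v \<in> l" "v \<in> m"
  obtains n where "n \<in> Red" "n \<noteq> l" "n \<noteq> m" "v \<in> n"
  using blue_pair[OF assms(1-3)] concurrent_third_line[of l m _ v] assms red_line blue_line
  by blast

lemma blue_through:
  assumes "l \<in> Red" "m \<in> Red" "l \<noteq> m" "v \<in> l" "v \<in> m"
  obtains n where "n \<in> Blue" "n \<noteq> l" "n \<noteq> m" "v \<in> n"
  using red_pair[OF assms(1-3)] concurrent_third_line[of l m _ v] assms red_line blue_line
  by blast

text \<open>
  The two vectors \<open>b\<close> and \<open>c\<close> are scaled so that the red line through \<open>a\<close> meets the side \<open>bc\<close> in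
  \<open>b + c\<close>. Choosing signs here amounts to choosing one of the four regions bounded by the three
  lines, so \<open>cone3 a b c\<close> is a region that the red line crosses.
\<close>

definition crossed_triangle :: "real ^ 3 \<Rightarrow> real ^ 3 \<Rightarrow> real ^ 3 \<Rightarrow> bool" where
  "crossed_triangle a b c \<longleftrightarrow> lin_indep3 a b c \<and>
     (\<exists>l\<in>Blue. a \<in> l \<and> b \<in> l) \<and> (\<exists>l\<in>Blue. a \<in> l \<and> c \<in> l) \<and>
     (\<exists>l\<in>Red. b \<in> l \<and> c \<in> l) \<and> (\<exists>l\<in>Red. a \<in> l \<and> b + c \<in> l)"

lemma crossed_triangle_swap: "crossed_triangle a b c \<Longrightarrow> crossed_triangle a c b"
  unfolding crossed_triangle_def using lin_indep3_swap[of a b c]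
  by (simp only: add.commute[of c b]) blast

definition vertices :: "(real ^ 3) set set" where
  "vertices = {l \<inter> m |l m. l \<in> Red \<union> Blue \<and> m \<in> Red \<union> Blue \<and> l \<noteq> m}"

text \<open>
  Cones have no finite size, but the arrangement has only finitely many points where
  lines meet; the descent is measured by how many of them lie in the triangle.
\<close>

definition vertices_meeting :: "(real ^ 3) set \<Rightarrow> (real ^ 3) set set" where
  "vertices_meeting K = {p \<in> vertices. \<exists>v\<in>p. v \<noteq> 0 \<and> v \<in> K}"

lemma finite_vertices: "finite vertices"
proof (rule finite_subset)
  show "vertices \<subseteq> (\<lambda>(l, m). l \<inter> m) ` ((Red \<union> Blue) \<times> (Red \<union> Blue))"
    unfolding vertices_def by auto
qed (use finite_lines in blast)

lemma vertices_meeting_less: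
  assumes "K' \<subseteq> K" "l \<in> Red \<union> Blue" "m \<in> Red \<union> Blue" "l \<noteq> m"
    and v: "v \<in> l" "v \<in> m" "v \<noteq> 0" "v \<in> K" and out: "\<And>k. k *\<^sub>R v \<in> K' \<Longrightarrow> k *\<^sub>R v = 0"
  shows "card (vertices_meeting K') < card (vertices_meeting K)"
proof (rule psubset_card_mono)
  show "finite (vertices_meeting K)"
    using finite_vertices unfolding vertices_meeting_def by simp
  have "l \<inter> m \<in> vertices_meeting K"
    using assms unfolding vertices_meeting_def vertices_def by blast
  moreover have "l \<inter> m \<notin> vertices_meeting K'"
  proof
    assume "l \<inter> m \<in> vertices_meeting K'"
    then obtain w where w: "w \<in> l" "w \<in> m" "w \<noteq> 0" "w \<in> K'"
      unfolding vertices_meeting_def by blast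
    with assms lines obtain k where "w = k *\<^sub>R v"
      using distinct_lines_inter[of l m v w] by blast
    with w out show False by blast
  qed
  moreover have "vertices_meeting K' \<subseteq> vertices_meeting K"
    using \<open>K' \<subseteq> K\<close> unfolding vertices_meeting_def by blast
  ultimately show "vertices_meeting K' \<subset> vertices_meeting K" by blast
qed

text \<open>
  The two red lines through \<open>d = b + c\<close> force a blue line through \<open>d\<close>. It passes through no
  corner of the triangle: through \<open>b\<close> or \<open>c\<close> it would be the side \<open>bc\<close>, and through \<open>a\<close> it would be
  the crossing red line.
  A line that enters a triangle through one side leaves it through another one. Algebraically, if it
  contains \<open>a + s b\<close> with \<open>s < 0\<close>, then it contains \<open>(a + s b) - s d = a - s c\<close>.
\<close>

lemma blue_cut:
  assumes "crossed_triangle a b c"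
  obtains k t where "k \<in> Blue" "b + c \<in> k" "t > 0" "a + t *\<^sub>R b \<in> k \<or> a + t *\<^sub>R c \<in> k"
proof -
  from assms obtain lab lbc lad where ind: "lin_indep3 a b c"
    and lab: "lab \<in> Blue" "a \<in> lab" "b \<in> lab"
    and lbc: "lbc \<in> Red" "b \<in> lbc" "c \<in> lbc"
    and lad: "lad \<in> Red" "a \<in> lad" "b + c \<in> lad"
    unfolding crossed_triangle_def by blast
  note D = lin_indep3D[OF ind]
  have sub: "subspace l" if "l \<in> Red \<union> Blue" for l using lines[OF that] line_subspace by blast
  have "b + c \<in> lbc" using lbc sub by (simp add: subspace_add)
  moreover have "lbc \<noteq> lad"
    using line_not_lin_indep3[of lbc a b c] ind lbc lad red_line by blast
  ultimately obtain k where k: "k \<in> Blue" "k \<noteq> lbc" "k \<noteq> lad" "b + c \<in> k"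
    using blue_through lbc(1) lad(1,3) by metis
  have "b \<notin> k"
  proof
    assume "b \<in> k"
    have "k = lbc"
    proof (rule line_unique[of k b "b + c" lbc])
      show "x = 0 \<and> y = 0" if "x *\<^sub>R b + y *\<^sub>R (b + c) = 0" for x y
        using D[of 0 "x + y" y] that by (simp add: algebra_simps)
    qed (use \<open>b \<in> k\<close> k lbc \<open>b + c \<in> lbc\<close> red_line blue_line in auto)
    with k show False by simp
  qed
  have "a \<notin> k"
  proof
    assume "a \<in> k"
    have "k = lad"
    proof (rule line_unique[of k a "b + c" lad])
      show "x = 0 \<and> y = 0" if "x *\<^sub>R a + y *\<^sub>R (b + c) = 0" for x y
        using D[of x y y] that by (simp add: algebra_simps)
    qed (use \<open>a \<in> k\<close> k lad red_line blue_line in auto)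
    with k show False by simp
  qed
  obtain s where s: "s \<noteq> 0" "a + s *\<^sub>R b \<in> k"
  proof (rule line_crosses_line[of k lab a b])
    show "x = 0 \<and> y = 0" if "x *\<^sub>R a + y *\<^sub>R b = 0" for x y
      using D[of x y 0] that by simp
  qed (use k lab \<open>a \<notin> k\<close> \<open>b \<notin> k\<close> blue_line in auto)
  show thesis
  proof (cases "s > 0")
    case True
    with that k s show thesis by blast
  next
    case False
    have "(a + s *\<^sub>R b) + (- s) *\<^sub>R (b + c) \<in> k"
      using s(2) k(4) by (rule line_add_scale[OF blue_line[OF k(1)]])
    then have "a + (- s) *\<^sub>R c \<in> k" by (simp add: algebra_simps)
    with that[of k "- s"] k False s(1) show thesis by simp
  qed
qed

text \<open>
  With \<open>e = a + t b\<close> on the side \<open>ab\<close>, the blue lines \<open>ab\<close> and \<open>de\<close> force a red line through \<open>e\<close>. It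
  meets the line \<open>bc\<close> in a vector \<open>b + s d\<close>. For \<open>s > 0\<close> this point lies between \<open>b\<close> and \<open>d\<close>, so the
  red line crosses \<open>ebd\<close>. For \<open>s < 0\<close> it crosses \<open>ead\<close>, because it also contains
  \<open>e - t (b + s d) = a - t s d\<close>. The first triangle has lost the corner \<open>a\<close>, the
  second one the corner \<open>b\<close>, and both corners are meeting points of lines of the arrangement.
\<close>

lemma smaller_crossed_triangle_if_blue_cut:
  assumes "crossed_triangle a b c" and k: "k \<in> Blue" "b + c \<in> k" "a + t *\<^sub>R b \<in> k" and t: "t > 0"
  shows "\<exists>a' b' c'. crossed_triangle a' b' c' \<and>
    card (vertices_meeting (cone3 a' b' c')) < card (vertices_meeting (cone3 a b c))"
proof -
  from assms(1) obtain lab lac lbc lad where ind: "lin_indep3 a b c"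
    and lab: "lab \<in> Blue" "a \<in> lab" "b \<in> lab"
    and lac: "lac \<in> Blue" "a \<in> lac" "c \<in> lac"
    and lbc: "lbc \<in> Red" "b \<in> lbc" "c \<in> lbc"
    and lad: "lad \<in> Red" "a \<in> lad" "b + c \<in> lad"
    unfolding crossed_triangle_def by blast
  note D = lin_indep3D[OF ind]
  have sub: "subspace l" if "l \<in> Red \<union> Blue" for l using lines[OF that] line_subspace by blast
  define d where "d = b + c"
  define e where "e = a + t *\<^sub>R b"
  have d: "d \<in> lbc" "d \<in> lad" "d \<in> k"
    using lbc lad k sub by (auto simp: d_def subspace_add)
  have e: "e \<in> lab" "e \<in> k"
    using lab k sub by (auto simp: e_def subspace_add subspace_scale)
  have "k \<noteq> lab"
  proof
    assume "k = lab"
    moreover have "lin_indep3 a b d"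
      unfolding lin_indep3_def d_def
    proof (intro allI impI)
      fix x y z assume "x *\<^sub>R a + y *\<^sub>R b + z *\<^sub>R (b + c) = 0"
      with D[of x "y + z" z] show "x = 0 \<and> y = 0 \<and> z = 0" by (simp add: algebra_simps)
    qed
    ultimately show False using line_not_lin_indep3[of lab a b d] lab d blue_line by blast
  qed
  with red_through k(1) lab(1) e obtain r where r: "r \<in> Red" "r \<noteq> k" "r \<noteq> lab" "e \<in> r"
    by metis
  have "d \<notin> r"
  proof
    assume "d \<in> r"
    have "r = k"
    proof (rule line_unique[of r d e k])
      show "x = 0 \<and> y = 0" if "x *\<^sub>R d + y *\<^sub>R e = 0" for x y
        using D[of y "x + t * y" x] that by (simp add: d_def e_def algebra_simps)
    qed (use \<open>d \<in> r\<close> r k d e red_line blue_line in auto)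
    with r show False by simp
  qed
  have "b \<notin> r"
  proof
    assume "b \<in> r"
    have "r = lab"
    proof (rule line_unique[of r b e lab])
      show "x = 0 \<and> y = 0" if "x *\<^sub>R b + y *\<^sub>R e = 0" for x y
        using D[of y "x + t * y" 0] that by (simp add: e_def algebra_simps)
    qed (use \<open>b \<in> r\<close> r lab e red_line blue_line in auto)
    with r show False by simp
  qed
  obtain s where s: "s \<noteq> 0" "b + s *\<^sub>R d \<in> r"
  proof (rule line_crosses_line[of r lbc b d])
    show "x = 0 \<and> y = 0" if "x *\<^sub>R b + y *\<^sub>R d = 0" for x y
      using D[of 0 "x + y" y] that by (simp add: d_def algebra_simps)
  qed (use r lbc d \<open>b \<notin> r\<close> \<open>d \<notin> r\<close> red_line in auto)
  show ?thesis
  proof (cases "s > 0")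
    case True
    have "crossed_triangle e b (s *\<^sub>R d)"
      unfolding crossed_triangle_def
    proof (intro conjI)
      show "lin_indep3 e b (s *\<^sub>R d)"
        unfolding lin_indep3_def
      proof (intro allI impI)
        fix x y z assume "x *\<^sub>R e + y *\<^sub>R b + z *\<^sub>R (s *\<^sub>R d) = 0"
        with D[of x "x * t + y + z * s" "z * s"] s(1) show "x = 0 \<and> y = 0 \<and> z = 0"
          by (simp add: d_def e_def algebra_simps)
      qed
      show "\<exists>l\<in>Blue. e \<in> l \<and> b \<in> l" using lab e by blast
      show "\<exists>l\<in>Blue. e \<in> l \<and> s *\<^sub>R d \<in> l" using k d e sub by (blast intro: subspace_scale)
      show "\<exists>l\<in>Red. b \<in> l \<and> s *\<^sub>R d \<in> l" using lbc d sub by (blast intro: subspace_scale)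
      show "\<exists>l\<in>Red. e \<in> l \<and> b + s *\<^sub>R d \<in> l" using r s by blast
    qed
    moreover have "card (vertices_meeting (cone3 e b (s *\<^sub>R d)))
        < card (vertices_meeting (cone3 a b c))"
    proof (rule vertices_meeting_less[of _ _ lab lac a])
      show "cone3 e b (s *\<^sub>R d) \<subseteq> cone3 a b c"
      proof
        fix v assume "v \<in> cone3 e b (s *\<^sub>R d)"
        then obtain x y z where "x \<ge> 0" "y \<ge> 0" "z \<ge> 0"
          and v: "v = x *\<^sub>R e + y *\<^sub>R b + z *\<^sub>R (s *\<^sub>R d)"
          unfolding cone3_def by blast
        then have "x *\<^sub>R a + (x * t + y + z * s) *\<^sub>R b + (z * s) *\<^sub>R c \<in> cone3 a b c"
          using t True by (intro cone3I) auto
        then show "v \<in> cone3 a b c" by (simp add: v d_def e_def algebra_simps)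
      qed
      show "lab \<noteq> lac"
        using line_not_lin_indep3[of lab a b c] ind lab lac blue_line by blast
      show "a \<noteq> 0" using D[of 1 0 0] by auto
      show "a \<in> cone3 a b c" using cone3I[of 1 0 0 a b c] by simp
      show "h *\<^sub>R a = 0" if "h *\<^sub>R a \<in> cone3 e b (s *\<^sub>R d)" for h
      proof -
        from that obtain x y z where nn: "x \<ge> 0" "y \<ge> 0" "z \<ge> 0"
          and v: "h *\<^sub>R a = x *\<^sub>R e + y *\<^sub>R b + z *\<^sub>R (s *\<^sub>R d)"
          unfolding cone3_def by blast
        then have "(x - h) *\<^sub>R a + (x * t + y + z * s) *\<^sub>R b + (z * s) *\<^sub>R c = 0"
          by (simp add: d_def e_def algebra_simps)
        from D[OF this] have "x * t + y + z * s = 0" "x = h" by auto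
        moreover have "x * t \<ge> 0" "z * s \<ge> 0" using nn t True by auto
        ultimately have "x * t = 0" using nn by linarith
        with t \<open>x = h\<close> show ?thesis by simp
      qed
    qed (use lab lac in auto)
    ultimately show ?thesis by blast
  next
    case False
    define s' where "s' = - (t * s)"
    have "s' > 0" using False s(1) t by (simp add: s'_def mult_pos_neg)
    have "e + (- t) *\<^sub>R (b + s *\<^sub>R d) \<in> r"
      using r(4) s(2) by (rule line_add_scale[OF red_line[OF r(1)]])
    then have s': "a + s' *\<^sub>R d \<in> r" by (simp add: s'_def e_def algebra_simps)
    have "crossed_triangle e a (s' *\<^sub>R d)"
      unfolding crossed_triangle_def
    proof (intro conjI)
      show "lin_indep3 e a (s' *\<^sub>R d)"
        unfolding lin_indep3_def
      proof (intro allI impI)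
        fix x y z assume "x *\<^sub>R e + y *\<^sub>R a + z *\<^sub>R (s' *\<^sub>R d) = 0"
        with D[of "x + y" "x * t + z * s'" "z * s'"] \<open>s' > 0\<close> t show "x = 0 \<and> y = 0 \<and> z = 0"
          by (simp add: d_def e_def algebra_simps)
      qed
      show "\<exists>l\<in>Blue. e \<in> l \<and> a \<in> l" using lab e by blast
      show "\<exists>l\<in>Blue. e \<in> l \<and> s' *\<^sub>R d \<in> l" using k d e sub by (blast intro: subspace_scale)
      show "\<exists>l\<in>Red. a \<in> l \<and> s' *\<^sub>R d \<in> l" using lad d sub by (blast intro: subspace_scale)
      show "\<exists>l\<in>Red. e \<in> l \<and> a + s' *\<^sub>R d \<in> l" using r s' by blast
    qed
    moreover have "card (vertices_meeting (cone3 e a (s' *\<^sub>R d)))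
        < card (vertices_meeting (cone3 a b c))"
    proof (rule vertices_meeting_less[of _ _ lab lbc b])
      show "cone3 e a (s' *\<^sub>R d) \<subseteq> cone3 a b c"
      proof
        fix v assume "v \<in> cone3 e a (s' *\<^sub>R d)"
        then obtain x y z where "x \<ge> 0" "y \<ge> 0" "z \<ge> 0"
          and v: "v = x *\<^sub>R e + y *\<^sub>R a + z *\<^sub>R (s' *\<^sub>R d)"
          unfolding cone3_def by blast
        then have "(x + y) *\<^sub>R a + (x * t + z * s') *\<^sub>R b + (z * s') *\<^sub>R c \<in> cone3 a b c"
          using t \<open>s' > 0\<close> by (intro cone3I) auto
        then show "v \<in> cone3 a b c" by (simp add: v d_def e_def algebra_simps)
      qed
      show "lab \<noteq> lbc"
        using line_not_lin_indep3[of lab a b c] ind lab lbc blue_line by blast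
      show "b \<noteq> 0" using D[of 0 1 0] by auto
      show "b \<in> cone3 a b c" using cone3I[of 0 1 0 a b c] by simp
      show "h *\<^sub>R b = 0" if "h *\<^sub>R b \<in> cone3 e a (s' *\<^sub>R d)" for h
      proof -
        from that obtain x y z where nn: "x \<ge> 0" "y \<ge> 0" "z \<ge> 0"
          and v: "h *\<^sub>R b = x *\<^sub>R e + y *\<^sub>R a + z *\<^sub>R (s' *\<^sub>R d)"
          unfolding cone3_def by blast
        then have "(x + y) *\<^sub>R a + (x * t + z * s' - h) *\<^sub>R b + (z * s') *\<^sub>R c = 0"
          by (simp add: d_def e_def algebra_simps)
        from D[OF this] have "x + y = 0" "z * s' = 0" "h = x * t + z * s'" by auto
        moreover have "x = 0" using \<open>x + y = 0\<close> nn by linarith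
        ultimately show ?thesis by auto
      qed
    qed (use lab lbc in auto)
    ultimately show ?thesis by blast
  qed
qed

lemma smaller_crossed_triangle:
  assumes "crossed_triangle a b c"
  shows "\<exists>a' b' c'. crossed_triangle a' b' c' \<and>
    card (vertices_meeting (cone3 a' b' c')) < card (vertices_meeting (cone3 a b c))"
proof -
  from blue_cut[OF assms] obtain k t where k: "k \<in> Blue" "b + c \<in> k" "t > 0"
    and "a + t *\<^sub>R b \<in> k \<or> a + t *\<^sub>R c \<in> k" .
  then consider "a + t *\<^sub>R b \<in> k" | "a + t *\<^sub>R c \<in> k" by blast
  then show ?thesis
  proof cases
    case 1
    then show ?thesis using smaller_crossed_triangle_if_blue_cut[OF assms k(1,2) _ k(3)] by blast
  next
    case 2
    have "c + b \<in> k" using k(2) by (simp add: add.commute)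
    then show ?thesis
      using smaller_crossed_triangle_if_blue_cut[OF crossed_triangle_swap[OF assms] k(1) _ 2 k(3)]
      by (simp add: cone3_swap[of a c b])
  qed
qed

lemma no_crossed_triangle: "\<not> crossed_triangle a b c"
proof (induction "card (vertices_meeting (cone3 a b c))" arbitrary: a b c rule: less_induct)
  case less
  then show ?case using smaller_crossed_triangle by blast
qed

text \<open>
  A red line \<open>r\<close> that misses \<open>a\<close> would form a triangle with \<open>l\<close> and \<open>m\<close>, and the red
  third line through \<open>a\<close> meets \<open>r\<close> in a vector \<open>b + s c\<close>. Replacing \<open>c\<close> by \<open>s c\<close>, whatever the sign of
  \<open>s\<close>, selects a region that this line crosses.
\<close>

lemma red_contains_blue_meet:
  assumes l: "l \<in> Blue" "a \<in> l" and m: "m \<in> Blue" "a \<in> m" and "l \<noteq> m" and "a \<noteq> 0"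
    and r: "r \<in> Red"
  shows "a \<in> r"
proof (rule ccontr)
  assume "a \<notin> r"
  have sub: "subspace l" if "l \<in> Red \<union> Blue" for l using lines[OF that] line_subspace by blast
  obtain b where b: "b \<in> l" "b \<in> r" "b \<noteq> 0"
    using lines_meet l(1) r red_line blue_line by metis
  obtain c where c: "c \<in> m" "c \<in> r" "c \<noteq> 0"
    using lines_meet m(1) r red_line blue_line by metis
  have ind: "lin_indep3 a b c"
    unfolding lin_indep3_def
  proof (intro allI impI)
    fix x y z assume eq: "x *\<^sub>R a + y *\<^sub>R b + z *\<^sub>R c = 0"
    have "x = 0"
    proof (rule ccontr)
      assume "x \<noteq> 0"
      have "x *\<^sub>R a = - (y *\<^sub>R b + z *\<^sub>R c)"
        using eq by (simp only: eq_neg_iff_add_eq_0 add.assoc)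
      also have "\<dots> \<in> r"
        using b c r sub[of r] by (intro subspace_neg subspace_add subspace_scale) auto
      finally have "a \<in> r" using line_scaleD r red_line \<open>x \<noteq> 0\<close> by metis
      with \<open>a \<notin> r\<close> show False by simp
    qed
    moreover have "y = 0"
    proof (rule ccontr)
      assume "y \<noteq> 0"
      have "y *\<^sub>R b = - (z *\<^sub>R c)" using eq \<open>x = 0\<close> by (simp add: eq_neg_iff_add_eq_0)
      also have "\<dots> \<in> m" using c m sub[of m] by (intro subspace_neg subspace_scale) auto
      finally have "b \<in> m" using line_scaleD m(1) blue_line \<open>y \<noteq> 0\<close> by metis
      then obtain h where "a = h *\<^sub>R b"
        using distinct_lines_inter[of l m b a] l m b \<open>l \<noteq> m\<close> blue_line by metis
      then have "a \<in> r" using b r sub by (auto intro: subspace_scale)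
      with \<open>a \<notin> r\<close> show False by simp
    qed
    ultimately show "x = 0 \<and> y = 0 \<and> z = 0" using eq c by auto
  qed
  note D = lin_indep3D[OF ind]
  obtain n where n: "n \<in> Red" "n \<noteq> l" "n \<noteq> m" "a \<in> n"
    using red_through[OF l(1) m(1) \<open>l \<noteq> m\<close> l(2) m(2)] by blast
  have "c \<notin> n"
  proof
    assume "c \<in> n"
    have "n = m"
    proof (rule line_unique[of n a c m])
      show "x = 0 \<and> y = 0" if "x *\<^sub>R a + y *\<^sub>R c = 0" for x y
        using D[of x 0 y] that by simp
    qed (use \<open>c \<in> n\<close> n m c red_line blue_line in auto)
    with n show False by simp
  qed
  have "b \<notin> n"
  proof
    assume "b \<in> n"
    have "n = l"
    proof (rule line_unique[of n a b l])
      show "x = 0 \<and> y = 0" if "x *\<^sub>R a + y *\<^sub>R b = 0" for x y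
        using D[of x y 0] that by simp
    qed (use \<open>b \<in> n\<close> n l b red_line blue_line in auto)
    with n show False by simp
  qed
  obtain s where s: "s \<noteq> 0" "b + s *\<^sub>R c \<in> n"
  proof (rule line_crosses_line[of n r b c])
    show "x = 0 \<and> y = 0" if "x *\<^sub>R b + y *\<^sub>R c = 0" for x y
      using D[of 0 x y] that by simp
  qed (use n r b c \<open>b \<notin> n\<close> \<open>c \<notin> n\<close> red_line in auto)
  have "crossed_triangle a b (s *\<^sub>R c)"
    unfolding crossed_triangle_def
  proof (intro conjI)
    show "lin_indep3 a b (s *\<^sub>R c)"
      unfolding lin_indep3_def
    proof (intro allI impI)
      fix x y z assume "x *\<^sub>R a + y *\<^sub>R b + z *\<^sub>R (s *\<^sub>R c) = 0"
      with D[of x y "z * s"] s(1) show "x = 0 \<and> y = 0 \<and> z = 0" by simp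
    qed
    show "\<exists>l\<in>Blue. a \<in> l \<and> b \<in> l" using l b by blast
    show "\<exists>l\<in>Blue. a \<in> l \<and> s *\<^sub>R c \<in> l" using m c sub by (blast intro: subspace_scale)
    show "\<exists>l\<in>Red. b \<in> l \<and> s *\<^sub>R c \<in> l" using r b c sub by (blast intro: subspace_scale)
    show "\<exists>l\<in>Red. a \<in> l \<and> b + s *\<^sub>R c \<in> l" using n s by blast
  qed
  then show False using no_crossed_triangle by blast
qed

lemma concurrent_if_two_blue:
  assumes "l \<in> Blue" "m \<in> Blue" "l \<noteq> m"
  shows "concurrent (Red \<union> Blue)"
proof -
  obtain a where a: "a \<in> l" "a \<in> m" "a \<noteq> 0"
    using lines_meet assms blue_line by metis
  have red: "a \<in> r" if "r \<in> Red" for r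
    using red_contains_blue_meet[of l a m r] assms a that by blast
  \<comment> \<open>A blue line \<open>k\<close> missing \<open>a\<close> meets \<open>l\<close> in another point \<open>q\<close>; the red third line there joins
    \<open>q\<close> and \<open>a\<close>, so it would be \<open>l\<close>.\<close>
  have blue: "a \<in> k" if k: "k \<in> Blue" for k
  proof (rule ccontr)
    assume "a \<notin> k"
    then have "l \<noteq> k" using a by blast
    obtain q where q: "q \<in> l" "q \<in> k" "q \<noteq> 0"
      using lines_meet assms(1) k blue_line by metis
    obtain n where n: "n \<in> Red" "n \<noteq> l" "q \<in> n"
      using red_through[OF assms(1) k \<open>l \<noteq> k\<close> q(1,2)] by blast
    obtain h where "a = h *\<^sub>R q"
      using distinct_lines_inter[of n l q a] n q a red red_line blue_line assms(1) by metis
    then have "a \<in> k"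
      using q k blue_line line_subspace by (auto intro: subspace_scale)
    with \<open>a \<notin> k\<close> show False by simp
  qed
  from a red blue lines show ?thesis by (intro concurrentI[of a]) auto
qed

end

theorem theorem1:
  fixes S Red Blue :: "(real ^ 3) set set"
  assumes "finite S"
    and "\<forall>l\<in>S. proj_line l"
    and "S = Red \<union> Blue"
    and "\<forall>l\<in>Blue. \<forall>m\<in>Blue. l \<noteq> m \<longrightarrow> (\<exists>n\<in>Red - {l, m}. concurrent {l, m, n})"
    and "\<forall>l\<in>Red. \<forall>m\<in>Red. l \<noteq> m \<longrightarrow> (\<exists>n\<in>Blue - {l, m}. concurrent {l, m, n})"
  shows "concurrent S"
proof -
  interpret rb: bicoloured_lines Red Blue
    using assms by unfold_locales auto
  interpret br: bicoloured_lines Blue Red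
    using assms by unfold_locales auto
  consider "\<exists>l\<in>Blue. \<exists>m\<in>Blue. l \<noteq> m" | "\<exists>l\<in>Red. \<exists>m\<in>Red. l \<noteq> m"
    | "\<forall>l\<in>Blue. \<forall>m\<in>Blue. l = m" "\<forall>l\<in>Red. \<forall>m\<in>Red. l = m"
    by metis
  then show ?thesis
  proof cases
    case 1
    then show ?thesis using rb.concurrent_if_two_blue assms(3) by blast
  next
    case 2
    then show ?thesis using br.concurrent_if_two_blue assms(3) Un_commute[of Red Blue] by metis
  next
    case 3
    \<comment> \<open>Here \<open>S\<close> has at most two lines; for empty \<open>S\<close> any point will do.\<close>
    show ?thesis
    proof (cases "S = {}")
      case True
      then show ?thesis using concurrentI[of "axis 1 1" S] by (simp add: axis_eq_0_iff)
    next
      case False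
      have single: "X = {} \<or> (\<exists>l. X = {l})" if "\<forall>l\<in>X. \<forall>m\<in>X. l = m" for X :: "(real ^ 3) set set"
        using that by blast
      from single[OF 3(1)] single[OF 3(2)] False assms(3) obtain l m where lm: "S = {l, m}"
        by auto
      then obtain v where "v \<in> l" "v \<in> m" "v \<noteq> 0"
        using lines_meet[of l m] assms(2) by auto
      with lm assms(2) show ?thesis by (intro concurrentI[of v]) auto
    qed
  qed
qed

end
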